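(* Let $\mathbb{B}_0=(X_1,X_2,X_3)$ be the basis of $\mathrm{sl}(2,\mathbb{R})$ with $[X_1,X_2]=2X_3$, $[X_3,X_1]=2X_2$, $[X_3,X_2]=2X_1$. Let $a\neq0$ be real and consider the left invariant metric on $\widetilde{\mathrm{PSL}}(2,\mathbb{R})$ with matrix in $\mathbb{B}_0$ $$\frac{2}{a^4(1+2a^2)}\begin{pmatrix}1-4a^4&(1+2a^2)^{3/2}&0\\(1+2a^2)^{3/2}&4a^4+6a^2+1&2\sqrt2\,a^3\\0&2\sqrt2\,a^3&4a^4\end{pmatrix}.$$ Its Ricci curvature and scalar curvature are $$M(\mathrm{ric},\mathbb{B}_0)=\begin{pmatrix}\frac{2a^2-9}{a^2}&\frac{-6a^2-9}{a^2\sqrt{2a^2+1}}&-\frac{6\sqrt2}{a\sqrt{2a^2+1}}\\ \frac{-6a^2-9}{a^2\sqrt{2a^2+1}}&\frac{-4a^4-14a^2-9}{2a^4+a^2}&-\frac{(6a^2+6)\sqrt2}{2a^3+a}\\-\frac{6\sqrt2}{a\sqrt{2a^2+1}}&-\frac{(6a^2+6)\sqrt2}{2a^3+a}&\frac{-4a^2-8}{2a^2+1}\end{pmatrix},\qquad\mathfrak{s}=-\frac32a^2.$$ The Ricci operator $\mathrm{Ric}$ is of type $\{a3\}$. Moreover $\det M(\mathrm{ric},\mathbb{B}_0)=8$, $\mathrm{tr}\,M(\mathrm{ric},\mathbb{B}_0)=-\frac{2(a^2+9)}{a^2}$, and the signature of $\mathrm{ric}$ is $(+,-,-)$.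
   Context: $\widetilde{\mathrm{PSL}}(2,\mathbb{R})$ is the universal covering group of $\mathrm{SL}(2,\mathbb{R})$. A left invariant metric on a Lie group with Lie algebra $\mathfrak{g}$ is identified with a nondegenerate symmetric bilinear form $\langle\,,\rangle$ on $\mathfrak{g}$. The Levi-Civita product $\mathrm{L}:\mathfrak{g}\times\mathfrak{g}\to\mathfrak{g}$ is given by $2\langle\mathrm{L}_uv,w\rangle=\langle[u,v],w\rangle+\langle[w,u],v\rangle+\langle[w,v],u\rangle$, the curvature by $\mathrm{K}(u,v)=\mathrm{L}_{[u,v]}-[\mathrm{L}_u,\mathrm{L}_v]$, the Ricci tensor by $\mathrm{ric}(u,v)=\mathrm{tr}(w\mapsto\mathrm{K}(u,w)v)$, the Ricci operator by $\langle\mathrm{Ric}(u),v\rangle=\mathrm{ric}(u,v)$, and the scalar curvature by $\mathfrak{s}=\mathrm{tr}(\mathrm{Ric})$. $M(\mathrm{ric},\mathbb{B}_0)$ is the Gram matrix of $\mathrm{ric}$ in $\mathbb{B}_0$. The signature of $\mathrm{ric}$ is its signature as a symmetric bilinear form (signs listed in any order). A symmetric endomorphism of a three dimensional Lorentzian vector space is of type $\{a3\}$ if its Jordan form is a single $3\times3$ Jordan block with a real eigenvalue (the letter $a$ in the name of the type is generic and not the parameter $a$ of the metric). *)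

theory Defs
  imports
    "HOL-Analysis.Analysis"
    "Jordan_Normal_Form.Jordan_Normal_Form"
begin

hide_const (open) Determinants.det Finite_Cartesian_Product.mat Determinants.trace
no_notation Matrix.vec_index (infixl "$" 100)

section \<open>Bases, Gram matrices, traces and signatures\<close>

definition is_basis :: "'v::real_vector list \<Rightarrow> bool" where
  "is_basis B \<longleftrightarrow> distinct B \<and> independent (set B) \<and> span (set B) = UNIV"

definition gram_matrix :: "('v \<Rightarrow> 'v \<Rightarrow> real) \<Rightarrow> 'v list \<Rightarrow> real mat" where
  "gram_matrix \<beta> B = mat (length B) (length B) (\<lambda>(i, j). \<beta> (B ! i) (B ! j))"

definition endo_matrix :: "('v::real_vector \<Rightarrow> 'v) \<Rightarrow> 'v list \<Rightarrow> real mat" where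
  "endo_matrix f B = mat (length B) (length B)
     (\<lambda>(i, j). representation (set B) (f (B ! j)) (B ! i))"

definition mat_trace :: "'a::comm_monoid_add mat \<Rightarrow> 'a" where
  "mat_trace A = (\<Sum>i<dim_row A. A $$ (i, i))"

text \<open>The trace of an endomorphism of a finite-dimensional space does not depend on the basis,
  so an arbitrary one is chosen.\<close>

definition endo_trace :: "('v::real_vector \<Rightarrow> 'v) \<Rightarrow> real" where
  "endo_trace f = mat_trace (endo_matrix f (SOME B. is_basis B))"

definition symmetric_bilinear :: "('v::real_vector \<Rightarrow> 'v \<Rightarrow> real) \<Rightarrow> bool" where
  "symmetric_bilinear \<beta> \<longleftrightarrow> bilinear \<beta> \<and> (\<forall>u v. \<beta> u v = \<beta> v u)"

text \<open>\<open>has_signature \<beta> p q\<close>: the symmetric bilinear form \<open>\<beta>\<close> has \<open>p\<close> plus and \<open>q\<close> minus signs;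
  any remaining members of the orthogonal basis are isotropic.\<close>

definition has_signature :: "('v::real_vector \<Rightarrow> 'v \<Rightarrow> real) \<Rightarrow> nat \<Rightarrow> nat \<Rightarrow> bool" where
  "has_signature \<beta> p q \<longleftrightarrow> symmetric_bilinear \<beta> \<and>
     (\<exists>B. is_basis B \<and> diagonal_mat (gram_matrix \<beta> B) \<and>
          card {i. i < length B \<and> \<beta> (B ! i) (B ! i) > 0} = p \<and>
          card {i. i < length B \<and> \<beta> (B ! i) (B ! i) < 0} = q)"

section \<open>Left invariant metrics and their curvature\<close>

text \<open>A left invariant metric on a Lie group is given by its value on the Lie algebra, here a real
  vector space with bracket \<open>br\<close>.  The Levi-Civita product and the Ricci operator are
  determined by nondegeneracy of the metric.\<close>

definition invariant_metric :: "('v::real_vector \<Rightarrow> 'v \<Rightarrow> real) \<Rightarrow> bool" where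
  "invariant_metric m \<longleftrightarrow> symmetric_bilinear m \<and> (\<forall>u. (\<forall>v. m u v = 0) \<longrightarrow> u = 0)"

definition levi_civita ::
  "('v::real_vector \<Rightarrow> 'v \<Rightarrow> 'v) \<Rightarrow> ('v \<Rightarrow> 'v \<Rightarrow> real) \<Rightarrow> 'v \<Rightarrow> 'v \<Rightarrow> 'v" where
  "levi_civita br m u v =
     (THE x. \<forall>w. 2 * m x w = m (br u v) w + m (br w u) v + m (br w v) u)"

definition curvature ::
  "('v::real_vector \<Rightarrow> 'v \<Rightarrow> 'v) \<Rightarrow> ('v \<Rightarrow> 'v \<Rightarrow> real) \<Rightarrow> 'v \<Rightarrow> 'v \<Rightarrow> 'v \<Rightarrow> 'v" where
  "curvature br m u v w =
     (let L = levi_civita br m in L (br u v) w - (L u (L v w) - L v (L u w)))"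

definition ricci_tensor ::
  "('v::real_vector \<Rightarrow> 'v \<Rightarrow> 'v) \<Rightarrow> ('v \<Rightarrow> 'v \<Rightarrow> real) \<Rightarrow> 'v \<Rightarrow> 'v \<Rightarrow> real" where
  "ricci_tensor br m u v = endo_trace (\<lambda>w. curvature br m u w v)"

definition ricci_operator ::
  "('v::real_vector \<Rightarrow> 'v \<Rightarrow> 'v) \<Rightarrow> ('v \<Rightarrow> 'v \<Rightarrow> real) \<Rightarrow> 'v \<Rightarrow> 'v" where
  "ricci_operator br m u = (THE x. \<forall>v. m x v = ricci_tensor br m u v)"

definition scalar_curvature ::
  "('v::real_vector \<Rightarrow> 'v \<Rightarrow> 'v) \<Rightarrow> ('v \<Rightarrow> 'v \<Rightarrow> real) \<Rightarrow> real" where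
  "scalar_curvature br m = endo_trace (ricci_operator br m)"

text \<open>Type \<open>{a3}\<close> for a symmetric endomorphism of a three dimensional Lorentzian space.
  Signature (2,1) forces the dimension to be 3 because the metric is nondegenerate, and the
  Jordan normal form is taken over the reals, so that the eigenvalue is real.\<close>

definition type_a3 :: "('v::real_vector \<Rightarrow> 'v \<Rightarrow> real) \<Rightarrow> ('v \<Rightarrow> 'v) \<Rightarrow> bool" where
  "type_a3 m f \<longleftrightarrow>
     invariant_metric m \<and> has_signature m 2 1 \<and>
     linear f \<and> (\<forall>u v. m (f u) v = m u (f v)) \<and>
     (\<exists>B. is_basis B \<and> (\<exists>c::real. jordan_nf (endo_matrix f B) [(3, c)]))"

section \<open>The Lie algebra of traceless real matrices\<close>

typedef sl2 = "{A :: real^2^2. Determinants.trace A = 0}"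
  by (rule exI[of _ 0]) (simp add: Determinants.trace_def)

setup_lifting type_definition_sl2

instantiation sl2 :: real_vector
begin

lift_definition zero_sl2 :: sl2 is 0
  by (simp add: Determinants.trace_def)

lift_definition plus_sl2 :: "sl2 \<Rightarrow> sl2 \<Rightarrow> sl2" is "(+)"
  by (simp add: Determinants.trace_add)

lift_definition minus_sl2 :: "sl2 \<Rightarrow> sl2 \<Rightarrow> sl2" is "(-)"
  by (simp add: Determinants.trace_sub)

lift_definition uminus_sl2 :: "sl2 \<Rightarrow> sl2" is uminus
  by (simp add: Determinants.trace_def sum_negf)

lift_definition scaleR_sl2 :: "real \<Rightarrow> sl2 \<Rightarrow> sl2" is scaleR
  by (simp add: Determinants.trace_def flip: sum_distrib_left)

instance
  by standard (transfer; simp add: algebra_simps)+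

end

lift_definition sl2_bracket :: "sl2 \<Rightarrow> sl2 \<Rightarrow> sl2" is "\<lambda>A B. A ** B - B ** A"
  by (metis Determinants.trace_sub Determinants.trace_mul_sym right_minus_eq)

text \<open>The matrices \<open>E1 = ((0,1),(-1,0))\<close>, \<open>E2 = ((0,1),(1,0))\<close>, \<open>E3 = ((1,0),(0,-1))\<close> form a basis
  with \<open>[E1,E2] = 2 E3\<close>, \<open>[E3,E1] = 2 E2\<close>, \<open>[E3,E2] = 2 E1\<close>, so that the hypotheses on
  such a basis are satisfiable.\<close>

lift_definition sl2_mat :: "real \<Rightarrow> real \<Rightarrow> real \<Rightarrow> sl2" is
  "\<lambda>x y z. vector [vector [z, x + y], vector [y - x, - z]]"
  by (simp add: Determinants.trace_def sum_2)

lemma sl2_mat_add: "sl2_mat x y z + sl2_mat x' y' z' = sl2_mat (x + x') (y + y') (z + z')"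
  by transfer (simp add: Finite_Cartesian_Product.vec_eq_iff forall_2)

lemma sl2_mat_scaleR: "c *\<^sub>R sl2_mat x y z = sl2_mat (c * x) (c * y) (c * z)"
  by transfer (simp add: Finite_Cartesian_Product.vec_eq_iff forall_2 algebra_simps)

lemma sl2_mat_zero: "(0::sl2) = sl2_mat 0 0 0"
  by transfer (simp add: Finite_Cartesian_Product.vec_eq_iff forall_2)

lemma sl2_mat_inject: "sl2_mat x y z = sl2_mat x' y' z' \<longleftrightarrow> x = x' \<and> y = y' \<and> z = z'"
  by transfer (auto simp: Finite_Cartesian_Product.vec_eq_iff forall_2)

lemma sl2_mat_surj: "\<exists>x y z. A = sl2_mat x y z"
proof (transfer, goal_cases)
  case (1 A)
  then have "A$2$2 = - A$1$1"
    by (simp add: Determinants.trace_def sum_2)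
  then have "A = vector [vector [A$1$1, (A$1$2 - A$2$1) / 2 + (A$1$2 + A$2$1) / 2],
      vector [(A$1$2 + A$2$1) / 2 - (A$1$2 - A$2$1) / 2, - A$1$1]]"
    by (simp add: Finite_Cartesian_Product.vec_eq_iff forall_2 flip: add_divide_distrib diff_divide_distrib)
  then show ?case
    by blast
qed

lemma sl2_bracket_mat:
  "sl2_bracket (sl2_mat x y z) (sl2_mat x' y' z') =
   sl2_mat (2 * (z * y' - y * z')) (2 * (z * x' - x * z')) (2 * (x * y' - y * x'))"
  by transfer (simp add: Finite_Cartesian_Product.vec_eq_iff forall_2 matrix_matrix_mult_def sum_2
      algebra_simps)

lemma sl2_standard_basis:
  defines "E1 \<equiv> sl2_mat 1 0 0" and "E2 \<equiv> sl2_mat 0 1 0" and "E3 \<equiv> sl2_mat 0 0 1"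
  shows "is_basis [E1, E2, E3]"
    and "sl2_bracket E1 E2 = 2 *\<^sub>R E3"
    and "sl2_bracket E3 E1 = 2 *\<^sub>R E2"
    and "sl2_bracket E3 E2 = 2 *\<^sub>R E1"
proof -
  have ne: "E1 \<noteq> E2" "E1 \<noteq> E3" "E2 \<noteq> E3"
    by (simp_all add: E1_def E2_def E3_def sl2_mat_inject)
  have "independent {E1, E2, E3}"
    using ne by (subst dependent_finite)
      (auto simp: E1_def E2_def E3_def sl2_mat_scaleR sl2_mat_add sl2_mat_zero sl2_mat_inject)
  moreover have "A \<in> span {E1, E2, E3}" for A
  proof -
    obtain x y z where "A = sl2_mat x y z"
      using sl2_mat_surj by blast
    then have "A = x *\<^sub>R E1 + (y *\<^sub>R E2 + z *\<^sub>R E3)"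
      by (simp add: E1_def E2_def E3_def sl2_mat_scaleR sl2_mat_add)
    then show ?thesis
      by (simp add: span_add span_scale span_base)
  qed
  ultimately show "is_basis [E1, E2, E3]"
    using ne by (auto simp: is_basis_def)
  show "sl2_bracket E1 E2 = 2 *\<^sub>R E3" "sl2_bracket E3 E1 = 2 *\<^sub>R E2"
    "sl2_bracket E3 E2 = 2 *\<^sub>R E1"
    unfolding E1_def E2_def E3_def
    by (simp_all add: sl2_bracket_mat sl2_mat_scaleR)
qed

end

(* With the cross product of the metric, the bracket is [u, v] = S (u x v) for a self-adjoint
   operator S whose only eigenvalue is a, with a single 3 x 3 Jordan block.  A Jordan chain of S can
   be normalised to a basis (e1, e2, e3) with <e1, e3> = <e2, e2> = 1, all other products being 0,
   in which [e1, e2] = a e1 + e2, [e2, e3] = a e3 and [e3, e1] = a e2 + e3.  In this frame the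
   Ricci operator is lower triangular with diagonal - a^2 / 2; the Gram matrix in the given basis
   follows by a change of basis. *)

theory Submission
  imports Defs
begin

section \<open>Bases, traces and three dimensional matrices\<close>

lemma mat_trace_endo_matrix:
  assumes "distinct B"
  shows "mat_trace (endo_matrix f B) = (\<Sum>b\<in>set B. representation (set B) (f b) b)"
proof -
  have "mat_trace (endo_matrix f B) =
      (\<Sum>i<length B. representation (set B) (f (B ! i)) (B ! i))"
    by (simp add: mat_trace_def endo_matrix_def)
  also have "\<dots> = (\<Sum>b\<in>set B. representation (set B) (f b) b)"
    using sum.reindex_bij_betw[OF bij_betw_nth[OF assms refl refl]] .
  finally show ?thesis .
qed

text \<open>Expanding each \<open>f b\<close> over \<open>C\<close> and each \<open>c\<close> over
  \<open>B\<close> gives a double sum whose two orders of summation are the two traces. This makes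
  the basis picked by \<open>SOME\<close> in \<open>endo_trace\<close> irrelevant for linear
  \<open>f\<close>.\<close>

lemma mat_trace_endo_matrix_cong:
  assumes B: "is_basis B" and C: "is_basis C" and f: "linear f"
  shows "mat_trace (endo_matrix f B) = mat_trace (endo_matrix f C)"
proof -
  let ?R = "representation (set B)" and ?S = "representation (set C)"
  have ind: "independent (set B)" "independent (set C)"
    and sp: "\<And>x. x \<in> span (set B)" "\<And>x. x \<in> span (set C)"
    using B C by (auto simp: is_basis_def)
  have expC: "(\<Sum>c\<in>set C. ?S x c *\<^sub>R c) = x" for x
    by (rule real_vector.sum_representation_eq) (use ind sp in auto)
  have expB: "(\<Sum>b\<in>set B. ?R x b *\<^sub>R b) = x" for x
    by (rule real_vector.sum_representation_eq) (use ind sp in auto)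
  have R: "?R (\<Sum>c\<in>set C. g c *\<^sub>R h c) b = (\<Sum>c\<in>set C. g c * ?R (h c) b)" for g h b
    using ind sp by (simp add: real_vector.representation_sum real_vector.representation_scale)
  have S: "?S (\<Sum>b\<in>set B. g b *\<^sub>R h b) c = (\<Sum>b\<in>set B. g b * ?S (h b) c)" for g h c
    using ind sp by (simp add: real_vector.representation_sum real_vector.representation_scale)
  have "(\<Sum>b\<in>set B. ?R (f b) b) = (\<Sum>b\<in>set B. \<Sum>c\<in>set C. ?S (f b) c * ?R c b)"
    by (simp add: expC flip: R[of _ "\<lambda>c. c"])
  also have "\<dots> = (\<Sum>c\<in>set C. \<Sum>b\<in>set B. ?R c b * ?S (f b) c)"
    by (subst sum.swap) (simp add: mult.commute)
  also have "\<dots> = (\<Sum>c\<in>set C. ?S (f (\<Sum>b\<in>set B. ?R c b *\<^sub>R b)) c)"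
    by (simp add: linear_sum[OF f] linear_scale[OF f] S del: expB)
  finally show ?thesis
    using B C by (simp add: expB is_basis_def mat_trace_endo_matrix)
qed

lemma endo_trace_eq:
  assumes "is_basis B" and "linear f"
  shows "endo_trace f = mat_trace (endo_matrix f B)"
  unfolding endo_trace_def
  by (intro mat_trace_endo_matrix_cong someI[of is_basis B] assms)

text \<open>A vector outside the span would enlarge \<open>C\<close> to an independent set with more
  elements than the spanning set \<open>B\<close>.\<close>

lemma span_eq_UNIV_card:
  fixes B :: "'v::real_vector list" and C :: "'v set"
  assumes B: "is_basis B" and ind: "independent C" and card: "card C = length B"
  shows "span C = UNIV"
proof (rule ccontr)
  assume "span C \<noteq> UNIV"
  then obtain y where y: "y \<notin> span C" by auto
  have cB: "card (set B) = length B" "span (set B) = UNIV"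
    using B by (auto simp: is_basis_def distinct_card)
  have "finite (insert y C) \<and> card (insert y C) \<le> card (set B)"
    using real_vector.independent_span_bound[of "set B" "insert y C"] cB ind y
    by (simp add: real_vector.independent_insert)
  moreover have "y \<notin> C"
    using y span_base by blast
  ultimately show False
    using card cB(1) by auto
qed

section \<open>Explicit 3 x 3 matrices and signatures\<close>

lemma all_less_3: "(\<forall>i<3. P i) \<longleftrightarrow> P 0 \<and> P 1 \<and> P (2::nat)"
  by (auto simp: eval_nat_numeral less_Suc_eq)

lemma sum_less_3: "(\<Sum>i<3. f i) = f 0 + f 1 + f (2::nat)"
  by (simp add: eval_nat_numeral)

lemma eq_mat_of_rows_list_3_iff:
  "A = mat_of_rows_list 3 [[a, b, c], [d, e, f], [g, h, i]] \<longleftrightarrow>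
    dim_row A = 3 \<and> dim_col A = 3 \<and>
    A $$ (0, 0) = a \<and> A $$ (0, 1) = b \<and> A $$ (0, 2) = c \<and>
    A $$ (1, 0) = d \<and> A $$ (1, 1) = e \<and> A $$ (1, 2) = f \<and>
    A $$ (2, 0) = g \<and> A $$ (2, 1) = h \<and> A $$ (2, 2) = i"
proof -
  have *: "A = B \<longleftrightarrow> dim_row A = 3 \<and> dim_col A = 3 \<and> (\<forall>i<3. \<forall>j<3. A $$ (i, j) = B $$ (i, j))"
    if "B \<in> carrier_mat 3 3" for B
    using that by (auto simp: mat_eq_iff)
  show ?thesis
    by (subst *) (simp_all add: mat_of_rows_list_def all_less_3 flip: numeral_3_eq_3)
qed

lemma det_mat_of_rows_list_3:
  "det (mat_of_rows_list 3 [[a, b, c], [d, e, f], [g, h, i]]) =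
    a * (e * i - f * h) - b * (d * i - f * g) + c * (d * h - e * (g::'a::comm_ring_1))"
proof -
  have det2: "det A = A $$ (0, 0) * A $$ (1, 1) - A $$ (0, 1) * A $$ (1, 0)"
    if A: "A \<in> carrier_mat 2 2" for A :: "'a mat"
  proof -
    have "det (mat_delete A 0 j) = mat_delete A 0 j $$ (0, 0)" for j
      using A by (intro det_single) (auto simp: mat_delete_def)
    then show ?thesis
      using laplace_expansion_row[OF A, of 0] A
      by (simp add: cofactor_def mat_delete_def numeral_2_eq_2)
  qed
  let ?A = "mat_of_rows_list 3 [[a, b, c], [d, e, f], [g, h, i]]"
  have A: "?A \<in> carrier_mat 3 3"
    by (simp add: mat_of_rows_list_def flip: numeral_3_eq_3)
  then have "mat_delete ?A 0 j \<in> carrier_mat 2 2" for j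
    by (simp add: mat_delete_def)
  from det2[OF this] show ?thesis
    using laplace_expansion_row[OF A, of 0]
    by (simp add: sum_less_3 cofactor_def) (simp add: mat_delete_def mat_of_rows_list_def algebra_simps)
qed

lemma gram_matrix_3_iff:
  "gram_matrix \<beta> [x, y, z] = mat_of_rows_list 3 [[a, b, c], [d, e, f], [g, h, i]] \<longleftrightarrow>
    \<beta> x x = a \<and> \<beta> x y = b \<and> \<beta> x z = c \<and>
    \<beta> y x = d \<and> \<beta> y y = e \<and> \<beta> y z = f \<and>
    \<beta> z x = g \<and> \<beta> z y = h \<and> \<beta> z z = i"
  by (simp add: eq_mat_of_rows_list_3_iff gram_matrix_def)

lemma smult_mat_of_rows_list_3:
  "k \<cdot>\<^sub>m mat_of_rows_list 3 [[a, b, c], [d, e, f], [g, h, i]] =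
    mat_of_rows_list 3 [[k * a, k * b, k * c], [k * d, k * e, k * f], [k * g, k * h, k * i]]"
  by (simp add: eq_mat_of_rows_list_3_iff) (simp add: mat_of_rows_list_def)

lemma mat_trace_mat_of_rows_list_3:
  "mat_trace (mat_of_rows_list 3 [[a, b, c], [d, e, f], [g, h, i]]) = a + e + i"
  by (simp add: mat_trace_def mat_of_rows_list_def numeral_2_eq_2)

text \<open>Signs are counted with \<open>filter\<close>, which simplification evaluates on a
  concrete list, instead of by cardinalities of index sets.\<close>

lemma has_signature_3I:
  assumes "symmetric_bilinear \<beta>" "is_basis [x, y, z]"
    and "\<beta> x y = 0" "\<beta> x z = 0" "\<beta> y z = 0"
    and "length (filter (\<lambda>v. \<beta> v v > 0) [x, y, z]) = p"
    and "length (filter (\<lambda>v. \<beta> v v < 0) [x, y, z]) = q"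
  shows "has_signature \<beta> p q"
  unfolding has_signature_def
proof (intro conjI exI[of _ "[x, y, z]"] assms)
  have "\<beta> u v = \<beta> v u" for u v
    using assms(1) by (simp add: symmetric_bilinear_def)
  then show "diagonal_mat (gram_matrix \<beta> [x, y, z])"
    using assms(3-5) by (simp add: diagonal_mat_def gram_matrix_def all_less_3 flip: numeral_3_eq_3)
qed (use assms(6,7) in \<open>simp_all only: length_filter_conv_card\<close>)

lemma jordan_matrix_3:
  "jordan_matrix [(3, c)] = mat_of_rows_list 3 [[c, 1, 0], [0, c, 1], [0, 0, c]]"
  by (simp add: eq_mat_of_rows_list_3_iff jordan_matrix_def Let_def)

section \<open>Coordinates in a basis of three vectors\<close>

locale basis3 =
  fixes e1 e2 e3 :: "'v::real_vector"
  assumes basis: "is_basis [e1, e2, e3]"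
begin

text \<open>With vectors in this form, \<open>lc_inject\<close> reduces a vector identity to three
  identities between reals.\<close>

definition lc :: "real \<Rightarrow> real \<Rightarrow> real \<Rightarrow> 'v" where
  "lc x y z = x *\<^sub>R e1 + y *\<^sub>R e2 + z *\<^sub>R e3"

lemma lc_add: "lc x y z + lc x' y' z' = lc (x + x') (y + y') (z + z')"
  by (simp add: lc_def algebra_simps)

lemma lc_diff: "lc x y z - lc x' y' z' = lc (x - x') (y - y') (z - z')"
  by (simp add: lc_def algebra_simps)

lemma lc_scaleR: "k *\<^sub>R lc x y z = lc (k * x) (k * y) (k * z)"
  by (simp add: lc_def algebra_simps)

lemma e_eq_lc: "e1 = lc 1 0 0" "e2 = lc 0 1 0" "e3 = lc 0 0 1"
  by (simp_all add: lc_def)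

lemma zero_eq_lc: "0 = lc 0 0 0"
  by (simp add: lc_def)

lemma distinct_e: "e1 \<noteq> e2" "e1 \<noteq> e3" "e2 \<noteq> e3"
  using basis by (auto simp: is_basis_def)

lemma representation_lc:
  "representation {e1, e2, e3} (lc x y z) = (\<lambda>b. (if b = e1 then x else 0) +
     (if b = e2 then y else 0) + (if b = e3 then z else 0))"
proof -
  have "independent {e1, e2, e3}" "\<And>v. v \<in> span {e1, e2, e3}"
    using basis by (auto simp: is_basis_def)
  then show ?thesis
    by (auto simp: lc_def real_vector.representation_add real_vector.representation_scale
        real_vector.representation_basis)
qed

lemma lc_inject: "lc x y z = lc x' y' z' \<longleftrightarrow> x = x' \<and> y = y' \<and> z = z'"
proof
  assume "lc x y z = lc x' y' z'"
  then have "representation {e1, e2, e3} (lc x y z) b = representation {e1, e2, e3} (lc x' y' z') b" for b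
    by simp
  from this[of e1] this[of e2] this[of e3] show "x = x' \<and> y = y' \<and> z = z'"
    using distinct_e by (auto simp: representation_lc)
qed auto

lemma lc_surj:
  obtains x y z where "v = lc x y z"
proof -
  have "v \<in> span {e1, e2, e3}"
    using basis by (auto simp: is_basis_def)
  then obtain x y z where "v - x *\<^sub>R e1 - y *\<^sub>R e2 = z *\<^sub>R e3"
    by (auto simp: span_insert span_singleton)
  then have "v = lc x y z"
    by (simp add: lc_def algebra_simps)
  then show thesis
    by (rule that)
qed

text \<open>Cramer's rule gives independence, and counting dimensions gives the span.\<close>

lemma is_basis_lc:
  assumes det: "x1 * (y2 * z3 - y3 * z2) - x2 * (y1 * z3 - y3 * z1) + x3 * (y1 * z2 - y2 * z1) \<noteq> 0"
  shows "is_basis [lc x1 x2 x3, lc y1 y2 y3, lc z1 z2 z3]" (is "is_basis [?x, ?y, ?z]")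
proof -
  \<comment> \<open>Two equal rows would make the determinant vanish. Distinctness lets a sum over
    the set split into three terms.\<close>
  have ne: "?x \<noteq> ?y" "?x \<noteq> ?z" "?y \<noteq> ?z"
    using det by (auto simp: lc_inject algebra_simps)
  moreover have "independent {?x, ?y, ?z}"
  proof -
    let ?d = "x1 * (y2 * z3 - y3 * z2) - x2 * (y1 * z3 - y3 * z1) + x3 * (y1 * z2 - y2 * z1)"
    have zero: "r = 0 \<and> s = 0 \<and> t = 0"
      if "r *\<^sub>R ?x + (s *\<^sub>R ?y + t *\<^sub>R ?z) = 0" for r s t
    proof -
      have *: "r * x1 + s * y1 + t * z1 = 0" "r * x2 + s * y2 + t * z2 = 0"
        "r * x3 + s * y3 + t * z3 = 0"
        using that by (simp_all add: lc_scaleR lc_add zero_eq_lc lc_inject)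
      \<comment> \<open>Weighting the coordinate equations by cofactors isolates one coefficient at
        a time.\<close>
      have "r * ?d = (r * x1 + s * y1 + t * z1) * (y2 * z3 - y3 * z2) -
          (r * x2 + s * y2 + t * z2) * (y1 * z3 - y3 * z1) +
          (r * x3 + s * y3 + t * z3) * (y1 * z2 - y2 * z1)"
        "s * ?d = - (r * x1 + s * y1 + t * z1) * (x2 * z3 - x3 * z2) +
          (r * x2 + s * y2 + t * z2) * (x1 * z3 - x3 * z1) -
          (r * x3 + s * y3 + t * z3) * (x1 * z2 - x2 * z1)"
        "t * ?d = (r * x1 + s * y1 + t * z1) * (x2 * y3 - x3 * y2) -
          (r * x2 + s * y2 + t * z2) * (x1 * y3 - x3 * y1) +
          (r * x3 + s * y3 + t * z3) * (x1 * y2 - x2 * y1)"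
        by (simp_all add: algebra_simps)
      then have "r * ?d = 0" "s * ?d = 0" "t * ?d = 0"
        unfolding * by simp_all
      then show ?thesis
        using det by simp
    qed
    show ?thesis
      using ne zero by (subst dependent_finite) auto
  qed
  ultimately show ?thesis
    using span_eq_UNIV_card[OF basis, of "{?x, ?y, ?z}"] by (simp add: is_basis_def)
qed

lemma endo_matrix_lc:
  assumes "f e1 = lc a11 a21 a31" "f e2 = lc a12 a22 a32" "f e3 = lc a13 a23 a33"
  shows "endo_matrix f [e1, e2, e3] =
    mat_of_rows_list 3 [[a11, a12, a13], [a21, a22, a23], [a31, a32, a33]]"
  using assms distinct_e
  by (simp add: eq_mat_of_rows_list_3_iff endo_matrix_def representation_lc)

text \<open>The basis vectors appear as \<open>lc 1 0 0\<close> and so on, so that coordinate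
  formulas for \<open>f\<close> rewrite them directly.\<close>

lemma endo_trace_lc:
  assumes "linear f"
  shows "endo_trace f = representation {e1, e2, e3} (f (lc 1 0 0)) e1 +
    representation {e1, e2, e3} (f (lc 0 1 0)) e2 + representation {e1, e2, e3} (f (lc 0 0 1)) e3"
  using distinct_e
  by (simp add: endo_trace_eq[OF basis assms] mat_trace_endo_matrix flip: e_eq_lc)

lemma bilinear_lc:
  assumes "bilinear h"
  shows "h (lc x y z) (lc x' y' z') =
      (x * x') *\<^sub>R h e1 e1 + (x * y') *\<^sub>R h e1 e2 + (x * z') *\<^sub>R h e1 e3 +
      (y * x') *\<^sub>R h e2 e1 + (y * y') *\<^sub>R h e2 e2 + (y * z') *\<^sub>R h e2 e3 +
      (z * x') *\<^sub>R h e3 e1 + (z * y') *\<^sub>R h e3 e2 + (z * z') *\<^sub>R h e3 e3"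
  using assms by (simp add: lc_def bilinear_ladd bilinear_radd bilinear_lmul bilinear_rmul
      scaleR_add_right mult.commute)

lemma linear_lcI:
  assumes f: "\<And>x y z. f (lc x y z) = x *\<^sub>R f (lc 1 0 0) + y *\<^sub>R f (lc 0 1 0) + z *\<^sub>R f (lc 0 0 1)"
  shows "linear f"
proof (rule linearI)
  fix u v :: 'v and k :: real
  obtain x y z where u: "u = lc x y z" by (rule lc_surj)
  obtain x' y' z' where v: "v = lc x' y' z'" by (rule lc_surj)
  show "f (u + v) = f u + f v"
    \<comment> \<open>The hypothesis is used at chosen instances only: its right side contains
      instances of its left side.\<close>
    unfolding u v lc_add f[of x y z] f[of x' y' z'] f[of "_ + _"] by (simp add: algebra_simps)
  show "f (k *\<^sub>R u) = k *\<^sub>R f u"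
    unfolding u lc_scaleR f[of x y z] f[of "_ * _"] by (simp add: algebra_simps)
qed

end

section \<open>Levi-Civita product and Ricci operator of an invariant metric\<close>

text \<open>Nondegeneracy applied to \<open>x - y\<close>. This is the uniqueness behind the
  \<open>THE\<close> in \<open>levi_civita\<close> and in \<open>ricci_operator\<close>.\<close>

lemma invariant_metric_eqI:
  assumes "invariant_metric m" and "\<And>w. m x w = m y w"
  shows "x = y"
proof -
  have "m (x - y) w = 0" for w
    using bilinear_lsub[of m x y w] assms
    by (simp add: invariant_metric_def symmetric_bilinear_def)
  then show ?thesis
    using assms(1) by (metis eq_iff_diff_eq_0 invariant_metric_def)
qed

lemma levi_civita_eqI:
  assumes "invariant_metric m"
    and "\<And>w. 2 * m x w = m (br u v) w + m (br w u) v + m (br w v) u"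
  shows "levi_civita br m u v = x"
  unfolding levi_civita_def
proof (rule the_equality)
  fix y assume "\<forall>w. 2 * m y w = m (br u v) w + m (br w u) v + m (br w v) u"
  then have "2 * m y w = 2 * m x w" for w
    using assms(2) by simp
  then show "y = x"
    using invariant_metric_eqI[OF assms(1)] by simp
qed (use assms(2) in blast)

lemma ricci_operator_eqI:
  assumes "invariant_metric m" and "\<And>v. m x v = ricci_tensor br m u v"
  shows "ricci_operator br m u = x"
  unfolding ricci_operator_def
  by (rule the_equality) (use assms invariant_metric_eqI[OF assms(1)] in auto)

section \<open>The model frame\<close>

text \<open>Here e1 x e2 = e1, e2 x e3 = e3 and e3 x e1 = e2, so the brackets encode S e1 = a e1 +
  e2, S e2 = a e2 + e3 and S e3 = a e3.\<close>

locale a3_frame = basis3 e1 e2 e3 for e1 e2 e3 :: "'v::real_vector" +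
  fixes br :: "'v \<Rightarrow> 'v \<Rightarrow> 'v" and m :: "'v \<Rightarrow> 'v \<Rightarrow> real" and a :: real
  assumes bilinear_br: "bilinear br" and br_self: "br u u = 0"
    and br_e: "br e1 e2 = a *\<^sub>R e1 + e2" "br e2 e3 = a *\<^sub>R e3" "br e3 e1 = a *\<^sub>R e2 + e3"
    and symmetric_m: "symmetric_bilinear m"
    and m_e: "m e1 e1 = 0" "m e1 e2 = 0" "m e1 e3 = 1" "m e2 e2 = 1" "m e2 e3 = 0" "m e3 e3 = 0"
begin

lemma m_lc: "m (lc x y z) (lc x' y' z') = x * z' + y * y' + z * x'"
proof -
  have "m e2 e1 = 0" "m e3 e1 = 1" "m e3 e2 = 0"
    using m_e symmetric_m by (simp_all add: symmetric_bilinear_def)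
  moreover have "bilinear m"
    using symmetric_m by (simp add: symmetric_bilinear_def)
  ultimately show ?thesis
    by (simp add: bilinear_lc m_e)
qed

lemma br_commute: "br v u = - br u v"
proof -
  have "br v u + br u v = br (u + v) (u + v)"
    unfolding bilinear_ladd[OF bilinear_br] bilinear_radd[OF bilinear_br] by (simp add: br_self)
  then show ?thesis
    by (simp only: br_self eq_neg_iff_add_eq_0)
qed

lemma br_lc: "br (lc x y z) (lc x' y' z') =
    lc (a * (x * y' - y * x')) (x * y' - y * x' + a * (z * x' - x * z'))
      (a * (y * z' - z * y') + (z * x' - x * z'))"
proof -
  have "br e2 e1 = - (a *\<^sub>R e1 + e2)" "br e3 e2 = - (a *\<^sub>R e3)" "br e1 e3 = - (a *\<^sub>R e2 + e3)"
    using br_e br_commute by metis+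
  then show ?thesis
    by (simp add: bilinear_lc bilinear_br br_e br_self) (simp add: lc_def algebra_simps)
qed

lemma invariant_metric_m: "invariant_metric m"
  unfolding invariant_metric_def
proof (intro conjI allI impI symmetric_m)
  fix u assume *: "\<forall>v. m u v = 0"
  obtain x y z where u: "u = lc x y z" by (rule lc_surj)
  show "u = 0"
    using *[rule_format, of "lc 1 0 0"] *[rule_format, of "lc 0 1 0"] *[rule_format, of "lc 0 0 1"]
    by (simp add: u m_lc zero_eq_lc)
qed

text \<open>This is \<open>(tr S / 2 - S) u \<times> v\<close>, where \<open>[u, v] = S (u \<times> v)\<close>.\<close>

lemma levi_civita_lc:
  "levi_civita br m (lc u1 u2 u3) (lc v1 v2 v3) =
    lc (u1 * v1 + a / 2 * (u1 * v2 - u2 * v1))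
      (a / 2 * (u3 * v1 - u1 * v3) - u2 * v1)
      (u2 * v2 - u1 * v3 + a / 2 * (u2 * v3 - u3 * v2))"
proof (rule levi_civita_eqI[OF invariant_metric_m])
  fix w
  obtain x y z where w: "w = lc x y z" by (rule lc_surj)
  show "2 * m (lc (u1 * v1 + a / 2 * (u1 * v2 - u2 * v1))
      (a / 2 * (u3 * v1 - u1 * v3) - u2 * v1)
      (u2 * v2 - u1 * v3 + a / 2 * (u2 * v3 - u3 * v2))) w =
    m (br (lc u1 u2 u3) (lc v1 v2 v3)) w + m (br w (lc u1 u2 u3)) (lc v1 v2 v3) +
    m (br w (lc v1 v2 v3)) (lc u1 u2 u3)"
    by (simp add: w br_lc m_lc field_simps)
qed

lemma bilinear_levi_civita: "bilinear (levi_civita br m)"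
  unfolding bilinear_def
proof (intro conjI allI)
  show "linear (levi_civita br m u)" for u
    by (rule lc_surj[of u], rule linear_lcI)
      (simp add: levi_civita_lc lc_scaleR lc_add lc_inject field_simps)
  show "linear (\<lambda>u. levi_civita br m u v)" for v
    by (rule lc_surj[of v], rule linear_lcI)
      (simp add: levi_civita_lc lc_scaleR lc_add lc_inject field_simps)
qed

section \<open>Ricci curvature in the frame\<close>

lemma ricci_tensor_lc:
  "ricci_tensor br m (lc u1 u2 u3) (lc v1 v2 v3) =
    - 2 * u1 * v1 - a * (u1 * v2 + u2 * v1) - a\<^sup>2 / 2 * (u1 * v3 + u2 * v2 + u3 * v1)"
proof -
  note * = bilinear_br bilinear_levi_civita
  \<comment> \<open>Linearity allows the trace to be computed in the frame instead of the basis
    chosen by \<open>SOME\<close>.\<close>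
  have "linear (\<lambda>w. curvature br m u w v)" for u v
    unfolding curvature_def Let_def
    by (rule linearI)
      (simp_all add: bilinear_ladd bilinear_radd bilinear_lmul bilinear_rmul * algebra_simps)
  then show ?thesis
    unfolding ricci_tensor_def
    by (subst endo_trace_lc, assumption)
      (simp add: curvature_def Let_def br_lc levi_civita_lc lc_diff representation_lc distinct_e
        distinct_e[symmetric], simp add: field_simps power2_eq_square)
qed

lemma symmetric_bilinear_ricci_tensor: "symmetric_bilinear (ricci_tensor br m)"
proof -
  have sym: "ricci_tensor br m u v = ricci_tensor br m v u" for u v
    by (rule lc_surj[of u], rule lc_surj[of v]) (simp add: ricci_tensor_lc algebra_simps)
  have "linear (ricci_tensor br m u)" for u
  proof -
    obtain x y z where "u = lc x y z" by (rule lc_surj)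
    then show ?thesis
      by (auto intro!: linear_lcI simp: ricci_tensor_lc algebra_simps)
  qed
  moreover have "(\<lambda>u. ricci_tensor br m u v) = ricci_tensor br m v" for v
    by (rule ext) (rule sym)
  ultimately show ?thesis
    unfolding symmetric_bilinear_def bilinear_def using sym by simp
qed

text \<open>In terms of the nilpotent N = S - a, which sends e1 to e2, e2 to e3 and e3 to 0, this is
  Ric = - a^2/2 - a N - 2 N^2.\<close>

lemma ricci_operator_lc:
  "ricci_operator br m (lc x y z) =
    lc (- (a\<^sup>2 / 2) * x) (- a * x - a\<^sup>2 / 2 * y) (- 2 * x - a * y - a\<^sup>2 / 2 * z)"
proof (rule ricci_operator_eqI[OF invariant_metric_m])
  fix v
  show "m (lc (- (a\<^sup>2 / 2) * x) (- a * x - a\<^sup>2 / 2 * y) (- 2 * x - a * y - a\<^sup>2 / 2 * z)) v =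
      ricci_tensor br m (lc x y z) v"
    by (rule lc_surj[of v]) (simp add: m_lc ricci_tensor_lc algebra_simps)
qed

lemma linear_ricci_operator: "linear (ricci_operator br m)"
  by (rule linear_lcI) (simp add: ricci_operator_lc lc_scaleR lc_add lc_inject algebra_simps)

lemma scalar_curvature_eq: "scalar_curvature br m = - (3/2) * a\<^sup>2"
  unfolding scalar_curvature_def
  using distinct_e by (simp add: endo_trace_lc linear_ricci_operator ricci_operator_lc representation_lc)

section \<open>Signatures and Jordan type\<close>

lemma has_signature_m: "has_signature m 2 1"
proof (rule has_signature_3I)
  \<comment> \<open>The isotropic pair e1, e3 yields e1 + e3 and e1 - e3, of squares 2 and
    -2.\<close>
  show "is_basis [lc 0 1 0, lc 1 0 1, lc 1 0 (- 1)]"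
    by (rule is_basis_lc) simp
qed (simp_all add: symmetric_m m_lc)

lemma has_signature_ricci_tensor:
  assumes "a \<noteq> 0"
  shows "has_signature (ricci_tensor br m) 1 2"
proof (rule has_signature_3I[OF symmetric_bilinear_ricci_tensor])
  \<comment> \<open>The first vector is e2 corrected by a multiple of e3 to be
    \<open>ricci_tensor\<close>-orthogonal to e1 and e3; its square is - a^2/2. In the plane of e1
    and e3, both e3 and e1 - (2/a^2) e3 are isotropic; their sum and difference have squares - a^2
    and a^2.\<close>
  show "is_basis [lc 0 1 (- 2 / a), lc 1 0 (- 2 / a\<^sup>2 + 1), lc 1 0 (- 2 / a\<^sup>2 - 1)]"
    by (rule is_basis_lc) simp
qed (use assms in \<open>simp_all add: ricci_tensor_lc field_simps power2_eq_square\<close>)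

text \<open>The nilpotent part R = - a N - 2 N^2 of Ric satisfies R^2 = a^2 N^2, which is nonzero
  for nonzero a, so e1 generates a Jordan chain of length 3.\<close>

lemma type_a3_ricci_operator:
  assumes "a \<noteq> 0"
  shows "type_a3 m (ricci_operator br m)"
  unfolding type_a3_def
proof (intro conjI allI exI)
  show "m (ricci_operator br m u) v = m u (ricci_operator br m v)" for u v
    by (rule lc_surj[of u], rule lc_surj[of v]) (simp add: ricci_operator_lc m_lc algebra_simps)
  \<comment> \<open>\<open>(R\<^sup>2 e1, R e1, e1)\<close> for \<open>R = Ric + a\<^sup>2/2\<close>\<close>
  let ?f1 = "lc 0 0 (a\<^sup>2)" and ?f2 = "lc 0 (- a) (- 2)" and ?f3 = "lc 1 0 0"
  show B: "is_basis [?f1, ?f2, ?f3]"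
    by (rule is_basis_lc) (use assms in simp)
  interpret f: basis3 ?f1 ?f2 ?f3
    by unfold_locales (rule B)
  \<comment> \<open>Expanding \<open>f.lc\<close> writes the chain coordinates back in the original
    frame, where \<open>lc_inject\<close> compares them.\<close>
  have "endo_matrix (ricci_operator br m) [?f1, ?f2, ?f3] = jordan_matrix [(3, - (a\<^sup>2 / 2))]"
    unfolding jordan_matrix_3
    by (rule f.endo_matrix_lc; unfold ricci_operator_lc f.lc_def lc_scaleR lc_add lc_inject)
      (simp_all add: power2_eq_square)
  then show "jordan_nf (endo_matrix (ricci_operator br m) [?f1, ?f2, ?f3]) [(3, - (a\<^sup>2 / 2))]"
    by (simp add: jordan_nf_def similar_mat_refl[OF jordan_matrix_carrier])
qed (fact invariant_metric_m has_signature_m linear_ricci_operator)+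

end

section \<open>The frame for the metric\<close>

lemma bilinear_sl2_bracket: "bilinear sl2_bracket"
  unfolding bilinear_def linear_iff
  by (intro conjI allI; transfer)
    (simp_all add: Finite_Cartesian_Product.vec_eq_iff forall_2 matrix_matrix_mult_def sum_2 algebra_simps)

lemma sl2_bracket_self: "sl2_bracket A A = 0"
  by transfer simp

text \<open>The roots sqrt 2 and sqrt (1 + 2 a^2) enter as \<open>r\<close> and \<open>s\<close>,
  known only by their squares, so every check is a polynomial identity modulo two relations.\<close>

locale sl2_metric = X: basis3 X1 X2 X3 for X1 X2 X3 :: sl2 +
  fixes m :: "sl2 \<Rightarrow> sl2 \<Rightarrow> real" and a r s :: real
  assumes a: "a \<noteq> 0" and r: "r * r = 2" and s: "s * s = 1 + 2 * a\<^sup>2"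
    and brackets: "sl2_bracket X1 X2 = 2 *\<^sub>R X3" "sl2_bracket X3 X1 = 2 *\<^sub>R X2"
      "sl2_bracket X3 X2 = 2 *\<^sub>R X1"
    and bilinear_m: "bilinear m"
    and m_X: "m X1 X1 = 2 / (a ^ 4 * (s * s)) * (1 - 4 * a ^ 4)" "m X1 X2 = 2 / (a ^ 4 * (s * s)) * s ^ 3"
      "m X1 X3 = 0" "m X2 X1 = m X1 X2"
      "m X2 X2 = 2 / (a ^ 4 * (s * s)) * (4 * a ^ 4 + 6 * a\<^sup>2 + 1)"
      "m X2 X3 = 2 / (a ^ 4 * (s * s)) * (2 * r * a ^ 3)" "m X3 X1 = 0" "m X3 X2 = m X2 X3"
      "m X3 X3 = 2 / (a ^ 4 * (s * s)) * (4 * a ^ 4)"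
begin

lemma s_nonzero: "s \<noteq> 0"
proof
  assume "s = 0"
  then have "1 + 2 * a\<^sup>2 = 0"
    using s by simp
  then show False
    by (smt (verit) zero_le_power2)
qed

text \<open>The variants with a trailing factor match inside longer products, which
  \<open>algebra_simps\<close> nests to the right.\<close>

lemma reduce: "r * (r * x) = 2 * x" "s * s = 1 + 2 * (a * a)" "s * (s * x) = (1 + 2 * (a * a)) * x"
proof -
  show "s * s = 1 + 2 * (a * a)"
    by (simp add: s power2_eq_square)
  then show "r * (r * x) = 2 * x" "s * (s * x) = (1 + 2 * (a * a)) * x"
    using r by (metis mult.assoc)+
qed

lemmas expand_power = power2_eq_square power3_eq_cube power4_eq_xxxx

text \<open>If \<open>S\<close> is the self-adjoint operator with \<open>[u, v] = S (u \<times> v)\<close>, then \<open>N = S - a\<close> is nilpotent,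
  \<open>E2 = s/2 N X3\<close>, \<open>E3 = s/2 N\<^sup>2 X3\<close> and \<open>E1 = s/2 X3 - E3\<close>.\<close>

definition E1 where "E1 = X.lc (r * a / 4) (- (r * a / (4 * s))) ((1 + a\<^sup>2) / (2 * s))"
definition E2 where "E2 = X.lc 0 (r * a\<^sup>2 / (2 * s)) (- (a / (2 * s)))"
definition E3 where "E3 = X.lc (- (r * a / 4)) (r * a / (4 * s)) (a\<^sup>2 / (2 * s))"

lemma sl2_bracket_lc:
  "sl2_bracket (X.lc x y z) (X.lc x' y' z') =
    X.lc (2 * (z * y' - y * z')) (2 * (z * x' - x * z')) (2 * (x * y' - y * x'))"
proof -
  have "sl2_bracket v u = - sl2_bracket u v" for u v
    by transfer simp
  then have "sl2_bracket X2 X1 = - (2 *\<^sub>R X3)" "sl2_bracket X1 X3 = - (2 *\<^sub>R X2)"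
    "sl2_bracket X2 X3 = - (2 *\<^sub>R X1)"
    using brackets by metis+
  then show ?thesis
    by (simp add: X.bilinear_lc bilinear_sl2_bracket brackets sl2_bracket_self)
      (simp add: X.lc_def algebra_simps)
qed

lemma is_basis_E: "is_basis [E1, E2, E3]"
  unfolding E1_def E2_def E3_def
proof (rule X.is_basis_lc)
  \<comment> \<open>This is the determinant of the coordinates of E1, E2, E3; by the two relations
    it equals a^3/8.\<close>
  have "r * a / 4 * (r * a\<^sup>2 / (2 * s) * (a\<^sup>2 / (2 * s)) - - (a / (2 * s)) * (r * a / (4 * s))) -
     - (r * a / (4 * s)) * (0 * (a\<^sup>2 / (2 * s)) - - (a / (2 * s)) * - (r * a / 4)) +
     (1 + a\<^sup>2) / (2 * s) * (0 * (r * a / (4 * s)) - r * a\<^sup>2 / (2 * s) * - (r * a / 4)) =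
     (r * r) * a ^ 3 * (1 + 2 * a\<^sup>2) / (16 * (s * s))"
    using s_nonzero by (simp add: field_simps power2_eq_square power3_eq_cube)
  also have "\<dots> \<noteq> 0"
    using a s_nonzero by (simp add: r flip: s)
  finally show "r * a / 4 * (r * a\<^sup>2 / (2 * s) * (a\<^sup>2 / (2 * s)) - - (a / (2 * s)) * (r * a / (4 * s))) -
     - (r * a / (4 * s)) * (0 * (a\<^sup>2 / (2 * s)) - - (a / (2 * s)) * - (r * a / 4)) +
     (1 + a\<^sup>2) / (2 * s) * (0 * (r * a / (4 * s)) - r * a\<^sup>2 / (2 * s) * - (r * a / 4)) \<noteq> 0" .
qed

lemma symmetric_bilinear_m: "symmetric_bilinear m"
proof -
  have "m u v = m v u" for u v
    by (rule X.lc_surj[of u], rule X.lc_surj[of v])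
      (simp add: X.bilinear_lc bilinear_m m_X(3,4,7,8) algebra_simps)
  then show ?thesis
    by (simp add: symmetric_bilinear_def bilinear_m)
qed

lemma m_lc:
  "m (X.lc x y z) (X.lc x' y' z') = 2 / (a ^ 4 * (s * s)) *
    (x * x' * (1 - 4 * a ^ 4) + (x * y' + y * x') * s ^ 3 + y * y' * (4 * a ^ 4 + 6 * a\<^sup>2 + 1) +
     (y * z' + z * y') * (2 * r * a ^ 3) + z * z' * (4 * a ^ 4))"
proof -
  \<comment> \<open>Naming the common factor keeps simplification from distributing its
    denominator.\<close>
  define k where "k = 2 / (a ^ 4 * (s * s))"
  show ?thesis
    unfolding X.bilinear_lc[OF bilinear_m] m_X k_def[symmetric] by (simp add: algebra_simps)
qed

text \<open>Each equation is cleared of denominators and its powers are spelled out as products, so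
  that \<open>reduce\<close> can eliminate squares of \<open>r\<close> and \<open>s\<close>.\<close>

sublocale a3_frame E1 E2 E3 sl2_bracket m a
proof
  show "sl2_bracket E1 E2 = a *\<^sub>R E1 + E2"
    unfolding E1_def E2_def sl2_bracket_lc X.lc_add X.lc_scaleR X.lc_inject
    using s_nonzero
    by (intro conjI; simp add: field_simps expand_power; simp add: reduce r algebra_simps)
  show "sl2_bracket E2 E3 = a *\<^sub>R E3"
    unfolding E2_def E3_def sl2_bracket_lc X.lc_add X.lc_scaleR X.lc_inject
    using s_nonzero
    by (intro conjI; simp add: field_simps expand_power; simp add: reduce r algebra_simps)
  show "sl2_bracket E3 E1 = a *\<^sub>R E2 + E3"
    unfolding E1_def E2_def E3_def sl2_bracket_lc X.lc_add X.lc_scaleR X.lc_inject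
    using s_nonzero
    by (intro conjI; simp add: field_simps expand_power; simp add: reduce r algebra_simps)
  show "m E1 E1 = 0"
    unfolding E1_def m_lc
    using s_nonzero a
    by (simp add: field_simps expand_power; simp add: reduce r algebra_simps)
  show "m E1 E2 = 0"
    unfolding E1_def E2_def m_lc
    using s_nonzero a
    by (simp add: field_simps expand_power; simp add: reduce r algebra_simps)
  show "m E1 E3 = 1"
    unfolding E1_def E3_def m_lc
    using s_nonzero a
    by (simp add: field_simps expand_power; simp add: reduce r algebra_simps)
  show "m E2 E2 = 1"
    unfolding E2_def m_lc
    using s_nonzero a
    by (simp add: field_simps expand_power; simp add: reduce r algebra_simps)
  show "m E2 E3 = 0"
    unfolding E2_def E3_def m_lc
    using s_nonzero a
    by (simp add: field_simps expand_power; simp add: reduce r algebra_simps)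
  show "m E3 E3 = 0"
    unfolding E3_def m_lc
    using s_nonzero a
    by (simp add: field_simps expand_power; simp add: reduce r algebra_simps)
qed (fact is_basis_E bilinear_sl2_bracket sl2_bracket_self symmetric_bilinear_m)+

section \<open>Transfer of the Ricci tensor to the given basis\<close>

lemma X_eq_lc:
  "X1 = lc (r / a) (r / a\<^sup>2) (- (r / a))"
  "X2 = lc (r / (a * s)) (r * s / a\<^sup>2) (r / (a * s))"
  "X3 = lc (2 / s) 0 (2 / s)"
proof -
  \<comment> \<open>Writing X1 as \<open>X.lc 1 0 0\<close> lets \<open>X.lc_inject\<close> compare
    both sides in X-coordinates.\<close>
  have "X.lc 1 0 0 = lc (r / a) (r / a\<^sup>2) (- (r / a))"
    unfolding lc_def unfolding E1_def E2_def E3_def X.lc_add X.lc_scaleR X.lc_inject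
    using s_nonzero a
    by (intro conjI; simp add: field_simps expand_power; simp add: reduce r algebra_simps)
  moreover have "X.lc 0 1 0 = lc (r / (a * s)) (r * s / a\<^sup>2) (r / (a * s))"
    unfolding lc_def unfolding E1_def E2_def E3_def X.lc_add X.lc_scaleR X.lc_inject
    using s_nonzero a
    by (intro conjI; simp add: field_simps expand_power; simp add: reduce r algebra_simps)
  moreover have "X.lc 0 0 1 = lc (2 / s) 0 (2 / s)"
    unfolding lc_def unfolding E1_def E2_def E3_def X.lc_add X.lc_scaleR X.lc_inject
    using s_nonzero a
    by (intro conjI; simp add: field_simps expand_power; simp add: reduce r algebra_simps)
  ultimately show "X1 = lc (r / a) (r / a\<^sup>2) (- (r / a))"
    "X2 = lc (r / (a * s)) (r * s / a\<^sup>2) (r / (a * s))" "X3 = lc (2 / s) 0 (2 / s)"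
    by (simp_all flip: X.e_eq_lc)
qed

text \<open>In factored form the denominators are visibly nonzero to
  \<open>field_simps\<close>.\<close>

lemma denominators:
  "2 * a ^ 4 + a\<^sup>2 = a * (a * (s * s))" "2 * a ^ 3 + a = a * (s * s)" "2 * a\<^sup>2 + 1 = s * s"
  by (simp_all add: s expand_power algebra_simps)

lemma gram_matrix_ricci_tensor:
  "gram_matrix (ricci_tensor sl2_bracket m) [X1, X2, X3] = mat_of_rows_list 3
    [[(2 * a\<^sup>2 - 9) / a\<^sup>2, (- 6 * a\<^sup>2 - 9) / (a\<^sup>2 * s), - (6 * r / (a * s))],
     [(- 6 * a\<^sup>2 - 9) / (a\<^sup>2 * s), (- 4 * a ^ 4 - 14 * a\<^sup>2 - 9) / (2 * a ^ 4 + a\<^sup>2),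
      - ((6 * a\<^sup>2 + 6) * r / (2 * a ^ 3 + a))],
     [- (6 * r / (a * s)), - ((6 * a\<^sup>2 + 6) * r / (2 * a ^ 3 + a)),
      (- 4 * a\<^sup>2 - 8) / (2 * a\<^sup>2 + 1)]]"
proof -
  \<comment> \<open>The entries are computed for the coordinate vectors and folded back with
    \<open>X_eq_lc\<close>. Unfolding it would not terminate, because E1, E2, E3 themselves contain
    X1, X2, X3.\<close>
  have "gram_matrix (ricci_tensor sl2_bracket m) [lc (r / a) (r / a\<^sup>2) (- (r / a)),
        lc (r / (a * s)) (r * s / a\<^sup>2) (r / (a * s)), lc (2 / s) 0 (2 / s)] = mat_of_rows_list 3
      [[(2 * a\<^sup>2 - 9) / a\<^sup>2, (- 6 * a\<^sup>2 - 9) / (a\<^sup>2 * s), - (6 * r / (a * s))],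
       [(- 6 * a\<^sup>2 - 9) / (a\<^sup>2 * s), (- 4 * a ^ 4 - 14 * a\<^sup>2 - 9) / (2 * a ^ 4 + a\<^sup>2),
        - ((6 * a\<^sup>2 + 6) * r / (2 * a ^ 3 + a))],
       [- (6 * r / (a * s)), - ((6 * a\<^sup>2 + 6) * r / (2 * a ^ 3 + a)),
        (- 4 * a\<^sup>2 - 8) / (2 * a\<^sup>2 + 1)]]"
    unfolding gram_matrix_3_iff ricci_tensor_lc denominators
    using s_nonzero a
    by (intro conjI; simp add: field_simps expand_power; simp add: reduce r algebra_simps)
  then show ?thesis
    by (simp only: X_eq_lc[symmetric])
qed

text \<open>The value reflects the determinant a^6/8 in the frame times the squared determinant
  (8/a^3)^2 of the base change; the proof expands the explicit entries.\<close>

lemma det_gram_matrix_ricci_tensor: "det (gram_matrix (ricci_tensor sl2_bracket m) [X1, X2, X3]) = 8"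
  unfolding gram_matrix_ricci_tensor det_mat_of_rows_list_3 denominators
  using s_nonzero a
  by (simp add: field_simps expand_power; simp add: reduce r algebra_simps)

lemma trace_gram_matrix_ricci_tensor:
  "mat_trace (gram_matrix (ricci_tensor sl2_bracket m) [X1, X2, X3]) = - (2 * (a\<^sup>2 + 9) / a\<^sup>2)"
  unfolding gram_matrix_ricci_tensor mat_trace_mat_of_rows_list_3 denominators
  using s_nonzero a
  by (simp add: field_simps expand_power; simp add: reduce r algebra_simps)

end

theorem proposition4p9:
  fixes a :: real
    and X1 X2 X3 :: sl2
    and m :: "sl2 \<Rightarrow> sl2 \<Rightarrow> real"
  assumes a: "a \<noteq> 0"
    and basis: "is_basis [X1, X2, X3]"
    and brackets: "sl2_bracket X1 X2 = 2 *\<^sub>R X3"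
      "sl2_bracket X3 X1 = 2 *\<^sub>R X2"
      "sl2_bracket X3 X2 = 2 *\<^sub>R X1"
    and bilinear: "bilinear m"
    and metric: "gram_matrix m [X1, X2, X3] =
      (2 / (a^4 * (1 + 2 * a^2))) \<cdot>\<^sub>m mat_of_rows_list 3
        [[1 - 4 * a^4, (1 + 2 * a^2) powr (3/2), 0],
         [(1 + 2 * a^2) powr (3/2), 4 * a^4 + 6 * a^2 + 1, 2 * sqrt 2 * a^3],
         [0, 2 * sqrt 2 * a^3, 4 * a^4]]"
  shows "invariant_metric m \<and>
    gram_matrix (ricci_tensor sl2_bracket m) [X1, X2, X3] = mat_of_rows_list 3
        [[(2 * a^2 - 9) / a^2,
          (- 6 * a^2 - 9) / (a^2 * sqrt (2 * a^2 + 1)),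
          - (6 * sqrt 2 / (a * sqrt (2 * a^2 + 1)))],
         [(- 6 * a^2 - 9) / (a^2 * sqrt (2 * a^2 + 1)),
          (- 4 * a^4 - 14 * a^2 - 9) / (2 * a^4 + a^2),
          - ((6 * a^2 + 6) * sqrt 2 / (2 * a^3 + a))],
         [- (6 * sqrt 2 / (a * sqrt (2 * a^2 + 1))),
          - ((6 * a^2 + 6) * sqrt 2 / (2 * a^3 + a)),
          (- 4 * a^2 - 8) / (2 * a^2 + 1)]] \<and>
    scalar_curvature sl2_bracket m = - (3/2) * a^2 \<and>
    type_a3 m (ricci_operator sl2_bracket m) \<and>
    det (gram_matrix (ricci_tensor sl2_bracket m) [X1, X2, X3]) = 8 \<and>
    mat_trace (gram_matrix (ricci_tensor sl2_bracket m) [X1, X2, X3]) = - (2 * (a^2 + 9) / a^2) \<and>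
    has_signature (ricci_tensor sl2_bracket m) 1 2"
proof -
  define s where "s = sqrt (2 * a\<^sup>2 + 1)"
  have s: "s * s = 1 + 2 * a\<^sup>2" "s > 0"
    by (auto simp: s_def add_nonneg_pos)
  \<comment> \<open>Positivity of \<open>s\<close> makes the square root of its square equal to
    \<open>s\<close>, so the real exponent becomes an ordinary cube.\<close>
  have "(1 + 2 * a\<^sup>2) powr (3/2) = ((s\<^sup>2) powr (1/2)) powr 3"
    by (simp add: powr_powr power2_eq_square s(1))
  also have "\<dots> = s ^ 3"
    using s(2) by (simp add: powr_half_sqrt real_sqrt_unique powr_numeral)
  finally have powr: "(1 + 2 * a\<^sup>2) powr (3/2) = s ^ 3" .
  interpret sl2_metric X1 X2 X3 m a "sqrt 2" s
    using basis a s(1) brackets bilinear metric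
    by unfold_locales (simp_all add: powr smult_mat_of_rows_list_3 gram_matrix_3_iff)
  show ?thesis
    using invariant_metric_m gram_matrix_ricci_tensor scalar_curvature_eq type_a3_ricci_operator[OF a]
      det_gram_matrix_ricci_tensor trace_gram_matrix_ricci_tensor has_signature_ricci_tensor[OF a]
    by (simp only: s_def[symmetric])
qed

end
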